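(* Let the observability matrix be such that $\operatorname{rank}\mathcal{O}_N(C,A)=\mathcal{R}<N$. Then there exists no basis of $\mathbb{R}^{N\times M}$ for which one can exactly recover more than $\mathcal{R}M$ coefficients. That is: for every basis $\{\widehat B_k\}_{k=1}^{NM}$ of $\mathbb{R}^{N\times M}$, every $\alpha^\star\in\mathbb{R}^{NM}$ and every finite family of controls $\epsilon^1,\dots,\epsilon^q\in E_{ad}$, there are at most $\mathcal{R}M$ indices $j\in\{1,\dots,NM\}$ such that every global minimizer $\alpha$ of $$\min_{\alpha\in\mathbb{R}^{NM}}\sum_{m=1}^q\Big\|C y_T\Big(\sum_{k=1}^{NM}\alpha_k^\star\widehat B_k,\epsilon^m\Big)-C y_T\Big(\sum_{k=1}^{NM}\alpha_k\widehat B_k,\epsilon^m\Big)\Big\|_2^2$$ satisfies $\alpha_j=\alpha_j^\star$.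
   Context: Let $N,M,P\ge 1$ be integers, $T>0$, $A\in\mathbb{R}^{N\times N}$, $C\in\mathbb{R}^{P\times N}$, $y_0\in\mathbb{R}^N$, and let $E_{ad}$ be a non-empty weakly compact subset of $L^2(0,T;\mathbb{R}^M)$. For $B\in\mathbb{R}^{N\times M}$ and $\epsilon\in L^2(0,T;\mathbb{R}^M)$, $y_T(B,\epsilon)$ denotes the value at time $T$ of the solution of $\dot y(t)=Ay(t)+B\epsilon(t)$, $t\in(0,T]$, $y(0)=y_0$. The observability matrix is $\mathcal{O}_N(C,A)=\begin{bmatrix} C \\ C A \\ \vdots \\ C A^{N-1} \end{bmatrix}$. The unknown control matrix is identified through its coefficients in a chosen basis, by solving the least-squares problem displayed in the claim. *)

theory Defs
  imports "HOL-Analysis.Analysis"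
begin

(* The type-class multiplication on real^'n^'n is componentwise, so the class power operation
   is not the matrix power. *)
primrec mat_pow :: "real^'n^'n \<Rightarrow> nat \<Rightarrow> real^'n^'n" where
  "mat_pow A 0 = mat 1"
| "mat_pow A (Suc k) = mat_pow A k ** A"

(* Rows are indexed by pairs (row i of C, block b). A finite index type carries no order;
   the block label b stands for the exponent to_nat_on UNIV b, and to_nat_on UNIV is a
   bijection from UNIV :: 'n set onto {..<CARD('n)}, so that each of the blocks
   C, C A, ..., C A^(N-1) occurs exactly once. *)
definition observability_matrix :: "real^'n^'p \<Rightarrow> real^'n^'n \<Rightarrow> real^'n^('p \<times> 'n)" where
  "observability_matrix C A =
     (\<chi> r. row (fst r) (C ** mat_pow A (to_nat_on (UNIV :: 'n set) (snd r))))"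

(* L2 functions are represented by measurable functions rather than by classes modulo
   almost everywhere equality. *)
definition L2_space :: "real \<Rightarrow> (real \<Rightarrow> real^'m) set" where
  "L2_space T = {f. f \<in> borel_measurable (lebesgue_on {0<..<T}) \<and>
                    integrable (lebesgue_on {0<..<T}) (\<lambda>t. (norm (f t))\<^sup>2)}"

definition L2_norm :: "real \<Rightarrow> (real \<Rightarrow> real^'m) \<Rightarrow> real" where
  "L2_norm T f = sqrt (integral\<^sup>L (lebesgue_on {0<..<T}) (\<lambda>t. (norm (f t))\<^sup>2))"

(* Boundedness with respect to L2_norm forces such a functional to respect almost everywhere
   equality, so these are exactly the elements of the dual of the quotient space. *)
definition L2_dual :: "real \<Rightarrow> ((real \<Rightarrow> real^'m) \<Rightarrow> real) set" where
  "L2_dual T = {l.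
     (\<forall>f\<in>L2_space T. \<forall>g\<in>L2_space T. l (\<lambda>t. f t + g t) = l f + l g) \<and>
     (\<forall>f\<in>L2_space T. \<forall>c. l (\<lambda>t. c *\<^sub>R f t) = c * l f) \<and>
     (\<exists>K. \<forall>f\<in>L2_space T. \<bar>l f\<bar> \<le> K * L2_norm T f)}"

(* The topology on representatives is the pullback of the weak topology of the quotient;
   hence a set of representatives is compact iff its image in the quotient is. *)
definition L2_weak_topology :: "real \<Rightarrow> (real \<Rightarrow> real^'m) topology" where
  "L2_weak_topology T =
     topology_generated_by {{f \<in> L2_space T. l f \<in> U} | l U. l \<in> L2_dual T \<and> open U}"

(* Solutions for an L2 control are taken in the Caratheodory sense: absolutely continuous
   with the equation holding almost everywhere, i.e. y(t) = y0 + integral of the right-hand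
   side over (0,t). *)
definition solves_on ::
  "real \<Rightarrow> real^'n^'n \<Rightarrow> real^'n \<Rightarrow> real^'m^'n \<Rightarrow> (real \<Rightarrow> real^'m) \<Rightarrow> (real \<Rightarrow> real^'n) \<Rightarrow> bool"
where
  "solves_on T A y0 B \<epsilon> y \<longleftrightarrow>
     continuous_on {0..T} y \<and>
     (\<forall>t\<in>{0..T}. ((\<lambda>s. A *v y s + B *v \<epsilon> s) has_integral (y t - y0)) {0..t})"

definition final_state ::
  "real \<Rightarrow> real^'n^'n \<Rightarrow> real^'n \<Rightarrow> real^'m^'n \<Rightarrow> (real \<Rightarrow> real^'m) \<Rightarrow> real^'n"
where
  "final_state T A y0 B \<epsilon> = (THE z. \<exists>y. solves_on T A y0 B \<epsilon> y \<and> y T = z)"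

definition is_basis_family :: "('k \<Rightarrow> 'v::real_vector) \<Rightarrow> bool" where
  "is_basis_family b \<longleftrightarrow> inj b \<and> independent (range b) \<and> span (range b) = UNIV"

(* A basis of the N x M matrices indexed by a finite type 'k forces CARD('k) = N M, so that
   real^'k is the coefficient space of dimension N M. *)
lemma card_basis_family:
  fixes Bhat :: "'k::finite \<Rightarrow> real^'m^'n"
  assumes "is_basis_family Bhat"
  shows "CARD('k) = CARD('n) * CARD('m)"
proof -
  have "dim (UNIV :: (real^'m^'n) set) = card (range Bhat)"
    using assms dim_span_eq_card_independent[of "range Bhat"]
    by (simp add: is_basis_family_def)
  moreover have "card (range Bhat) = CARD('k)"
    using assms by (simp add: is_basis_family_def card_image)
  ultimately show ?thesis by simp
qed

definition combine :: "('k::finite \<Rightarrow> real^'m^'n) \<Rightarrow> real^'k \<Rightarrow> real^'m^'n" where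
  "combine Bhat \<alpha> = (\<Sum>k\<in>UNIV. \<alpha> $ k *\<^sub>R Bhat k)"

end

(* If every C A^i annihilates D, then C y_T does not change when D is added to B, so all
   coefficient vectors whose matrix differs from the true one by an element of the kernel of
   L = (\<lambda>\<alpha>. O_N(C,A) ** combine Bhat \<alpha>) are global minimizers. A coordinate that is recovered
   therefore vanishes on ker L, hence L is injective on the span of the corresponding axis
   vectors, and their number is at most dim (range L). The columns of the matrices in range L
   lie in the column space of O_N(C,A), which bounds that dimension by R M. *)
theory Submission
  imports Defs
begin

section \<open>Linear Volterra equations on a compact interval\<close>

text \<open>The state equation in integral form reads \<open>y t = g t + volterra f y t\<close>,
  where \<open>f\<close> is multiplication by \<open>A\<close> and \<open>g\<close> collects the
  initial value and the integrated control.\<close>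

definition volterra :: "('a::euclidean_space \<Rightarrow> 'a) \<Rightarrow> (real \<Rightarrow> 'a) \<Rightarrow> real \<Rightarrow> 'a" where
  "volterra f u t = integral {0..t} (\<lambda>s. f (u s))"

context
  fixes f :: "'a::euclidean_space \<Rightarrow> 'a" and T :: real
  assumes f: "bounded_linear f"
begin

lemma continuous_on_integrand:
  "continuous_on {0..T} u \<Longrightarrow> t \<le> T \<Longrightarrow> continuous_on {0..t} (\<lambda>s. f (u s))"
  by (rule bounded_linear.continuous_on[OF f]) (erule continuous_on_subset, auto)

lemma volterra_integrand_integrable:
  "continuous_on {0..T} u \<Longrightarrow> t \<le> T \<Longrightarrow> (\<lambda>s. f (u s)) integrable_on {0..t}"
  by (intro integrable_continuous_interval continuous_on_integrand)

lemma continuous_on_volterra: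
  assumes "continuous_on {0..T} u" shows "continuous_on {0..T} (volterra f u)"
  unfolding volterra_def[abs_def]
  by (intro indefinite_integral_continuous_1 volterra_integrand_integrable assms order_refl)

lemma continuous_on_volterra_funpow:
  assumes "continuous_on {0..T} g" shows "continuous_on {0..T} ((volterra f ^^ k) g)"
  by (induction k) (auto intro: continuous_on_volterra assms)

text \<open>Each application integrates the previous bound times \<open>K\<close>, which turns
  \<open>(K * s) ^ k / fact k\<close> into the next term of the exponential series. The factorial
  yields convergence for every \<open>T\<close>, with no smallness condition.\<close>

lemma volterra_funpow_bound:
  assumes g: "continuous_on {0..T} g" and M: "\<And>t. t \<in> {0..T} \<Longrightarrow> norm (g t) \<le> M"
    and K: "\<And>x. norm (f x) \<le> K * norm x" "K \<ge> 0" and "t \<in> {0..T}"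
  shows "norm ((volterra f ^^ k) g t) \<le> M * ((K * t) ^ k / fact k)"
  using \<open>t \<in> {0..T}\<close>
proof (induction k arbitrary: t)
  case 0
  then show ?case using M by simp
next
  case (Suc k)
  let ?u = "(volterra f ^^ k) g"
  have "((\<lambda>s. K * (M * ((K * s) ^ k / fact k))) has_integral
         M * ((K * t) ^ Suc k / fact (Suc k)) - M * ((K * 0) ^ Suc k / fact (Suc k))) {0..t}"
  proof (rule fundamental_theorem_of_calculus[where f = "\<lambda>s. M * ((K * s) ^ Suc k / fact (Suc k))"])
    show "0 \<le> t" using Suc.prems by simp
    fix s assume "s \<in> {0..t}"
    show "((\<lambda>s. M * ((K * s) ^ Suc k / fact (Suc k))) has_vector_derivative
        K * (M * ((K * s) ^ k / fact k))) (at s within {0..t})"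
      unfolding has_real_derivative_iff_has_vector_derivative[symmetric]
      by (rule derivative_eq_intros refl | simp add: field_simps del: power_Suc of_nat_Suc)+
  qed
  then have I: "((\<lambda>s. K * (M * ((K * s) ^ k / fact k))) has_integral
         M * ((K * t) ^ Suc k / fact (Suc k))) {0..t}" by simp
  have "norm (volterra f ?u t) \<le> integral {0..t} (\<lambda>s. K * (M * ((K * s) ^ k / fact k)))"
    unfolding volterra_def[of f ?u t]
  proof (rule Henstock_Kurzweil_Integration.integral_norm_bound_integral)
    show "(\<lambda>s. f (?u s)) integrable_on {0..t}"
      using Suc.prems by (intro volterra_integrand_integrable continuous_on_volterra_funpow g) auto
    show "(\<lambda>s. K * (M * ((K * s) ^ k / fact k))) integrable_on {0..t}"
      using I by (rule has_integral_integrable)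
    fix s assume "s \<in> {0..t}"
    then have "norm (?u s) \<le> M * ((K * s) ^ k / fact k)"
      using Suc.prems by (intro Suc.IH) auto
    then show "norm (f (?u s)) \<le> K * (M * ((K * s) ^ k / fact k))"
      using K(1)[of "?u s"] mult_left_mono[OF _ K(2)] by (meson order_trans)
  qed
  then show ?case using integral_unique[OF I] by simp
qed

lemma norm_bounds:
  assumes "continuous_on {0..T} (g :: real \<Rightarrow> 'a)"
  obtains M K where "\<And>t. t \<in> {0..T} \<Longrightarrow> norm (g t) \<le> M" "M \<ge> 0"
    "\<And>x. norm (f x) \<le> K * norm x" "K \<ge> 0"
proof -
  have "bounded (g ` {0..T})"
    by (intro compact_imp_bounded compact_continuous_image assms) simp
  then obtain M where "M > 0" "\<forall>x\<in>g ` {0..T}. norm x \<le> M" by (auto simp: bounded_pos)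
  moreover obtain K where "K > 0" "\<forall>x. norm (f x) \<le> norm x * K"
    using bounded_linear.pos_bounded[OF f] by blast
  ultimately show ?thesis by (intro that[of M K]) (auto simp: mult.commute)
qed

lemma summable_exponential_bound: "summable (\<lambda>k. M * (x ^ k / fact k) :: real)"
  using summable_exp[of x] by (intro summable_mult) (simp add: field_simps)

text \<open>A fixed point of the operator is fixed by all its iterates, so the factorial bound holds
  for \<open>u\<close> itself with every \<open>k\<close> and tends to 0.\<close>

lemma volterra_homogeneous_unique:
  assumes u: "continuous_on {0..T} u" and eq: "\<And>t. t \<in> {0..T} \<Longrightarrow> u t = volterra f u t"
    and t: "t \<in> {0..T}"
  shows "u t = 0"
proof -
  obtain M K where MK: "\<And>t. t \<in> {0..T} \<Longrightarrow> norm (u t) \<le> M" "M \<ge> 0"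
    "\<And>x. norm (f x) \<le> K * norm x" "K \<ge> 0" using norm_bounds[OF u] by metis
  have iter: "(volterra f ^^ k) u s = u s" if "s \<in> {0..T}" for k s
    using that
  proof (induction k arbitrary: s)
    case (Suc k)
    have "integral {0..s} (\<lambda>r. f ((volterra f ^^ k) u r)) = integral {0..s} (\<lambda>r. f (u r))"
      using Suc.prems by (intro integral_cong) (simp add: Suc.IH)
    then show ?case using eq[OF Suc.prems] by (simp add: volterra_def[of f _ s])
  qed simp
  have "(\<lambda>k. M * ((K * t) ^ k / fact k)) \<longlonglongrightarrow> 0"
    by (rule summable_LIMSEQ_zero[OF summable_exponential_bound])
  moreover have "norm (u t) \<le> M * ((K * t) ^ k / fact k)" for k
    using volterra_funpow_bound[OF u MK(1,3,4) t, of k] iter[OF t] by simp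
  ultimately have "norm (u t) \<le> 0"
    by (intro LIMSEQ_le_const) auto
  then show ?thesis by simp
qed

text \<open>The bounded linear map \<open>h\<close> composed with \<open>f ^^ i\<close> commutes
  with the integral, and the \<open>f\<close> in the integrand raises \<open>i\<close> by one. Hence
  the induction on \<open>k\<close> treats all \<open>i\<close> at once.\<close>

lemma linear_functional_volterra_funpow:
  assumes g: "continuous_on {0..T} g" and h: "bounded_linear h"
    and hg: "\<And>i t. t \<in> {0..T} \<Longrightarrow> h ((f ^^ i) (g t)) = 0" and t: "t \<in> {0..T}"
  shows "h ((f ^^ i) ((volterra f ^^ k) g t)) = 0"
  using t
proof (induction k arbitrary: i t)
  case (Suc k)
  let ?u = "(volterra f ^^ k) g" and ?h = "\<lambda>x. h ((f ^^ i) x)"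
  have "bounded_linear (f ^^ i)"
  proof (induction i)
    case (Suc i)
    then show ?case using bounded_linear_compose[OF f Suc] by (simp add: comp_def)
  qed (simp add: id_def)
  then have "bounded_linear ?h" by (rule bounded_linear_compose[OF h])
  moreover have "(\<lambda>s. f (?u s)) integrable_on {0..t}"
    using Suc.prems by (intro volterra_integrand_integrable continuous_on_volterra_funpow g) auto
  ultimately have "?h (integral {0..t} (\<lambda>s. f (?u s))) = integral {0..t} (\<lambda>s. ?h (f (?u s)))"
    using integral_linear[of "\<lambda>s. f (?u s)" "{0..t}" ?h] by (simp add: comp_def)
  also have "\<dots> = integral {0..t} (\<lambda>s. 0)"
    using Suc.prems Suc.IH[of _ "Suc i"] by (intro integral_cong) (simp add: funpow_swap1)
  finally show ?case by (simp add: volterra_def[of f _ t])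
qed (simp add: hg)

text \<open>The solution is the Neumann series of the Volterra operator; h vanishes on each term.\<close>
lemma volterra_solution:
  assumes g: "continuous_on {0..T} g"
  obtains y where "continuous_on {0..T} y" "\<And>t. t \<in> {0..T} \<Longrightarrow> y t = g t + volterra f y t"
    "\<And>h :: 'a \<Rightarrow> 'b::euclidean_space. \<lbrakk>bounded_linear h;
       \<And>i t. t \<in> {0..T} \<Longrightarrow> h ((f ^^ i) (g t)) = 0\<rbrakk> \<Longrightarrow> \<forall>t\<in>{0..T}. h (y t) = 0"
proof -
  obtain M K where MK: "\<And>t. t \<in> {0..T} \<Longrightarrow> norm (g t) \<le> M" "M \<ge> 0"
    "\<And>x. norm (f x) \<le> K * norm x" "K \<ge> 0" using norm_bounds[OF g] by metis
  define a where "a k = (volterra f ^^ k) g" for k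
  define s where "s n t = (\<Sum>k<n. a k t)" for n t
  define y where "y t = (\<Sum>k. a k t)" for t
  have a_cont: "continuous_on {0..T} (a k)" for k
    unfolding a_def by (rule continuous_on_volterra_funpow[OF g])
  have s_cont: "continuous_on {0..T} (s n)" for n
    unfolding s_def[abs_def] by (intro continuous_on_sum a_cont)
  have a_bound: "norm (a k t) \<le> M * ((K * T) ^ k / fact k)" if "t \<in> {0..T}" for k t
  proof -
    have "norm (a k t) \<le> M * ((K * t) ^ k / fact k)"
      unfolding a_def by (rule volterra_funpow_bound[OF g MK(1,3,4) that])
    also have "\<dots> \<le> M * ((K * T) ^ k / fact k)"
      using that MK by (intro mult_left_mono divide_right_mono power_mono) auto
    finally show ?thesis .
  qed
  \<comment> \<open>The majorant at the right endpoint \<open>T\<close> does not depend on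
    \<open>t\<close>, so the convergence is uniform.\<close>
  have lim: "uniform_limit {0..T} s y sequentially"
    unfolding s_def[abs_def] y_def[abs_def]
    by (rule Weierstrass_m_test[OF a_bound summable_exponential_bound])
  have y_cont: "continuous_on {0..T} y"
    by (rule uniform_limit_theorem[OF _ lim]) (simp_all add: s_cont)
  \<comment> \<open>The partial sums are Picard iterates; the equation for \<open>y\<close> is the
    limit of this recursion.\<close>
  have s_Suc: "s (Suc n) t = g t + volterra f (s n) t" if "t \<in> {0..T}" for n t
  proof -
    have "volterra f (s n) t = integral {0..t} (\<lambda>r. \<Sum>k<n. f (a k r))"
      unfolding volterra_def s_def using f by (simp add: bounded_linear.linear linear_sum)
    also have "\<dots> = (\<Sum>k<n. integral {0..t} (\<lambda>r. f (a k r)))"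
      using that by (intro integral_sum volterra_integrand_integrable a_cont) auto
    also have "\<dots> = (\<Sum>k<n. a (Suc k) t)"
      by (simp add: a_def volterra_def)
    finally show ?thesis
      unfolding s_def sum.lessThan_Suc_shift by (simp add: a_def)
  qed
  have y_eq: "y t = g t + volterra f y t" if t: "t \<in> {0..T}" for t
  proof -
    \<comment> \<open>Uniform convergence allows the limit to pass under the integral.\<close>
    have "uniform_limit {0..t} (\<lambda>n r. f (s n r)) (\<lambda>r. f (y r)) sequentially"
      using t by (intro bounded_linear.uniform_limit[OF f] uniform_limit_on_subset[OF lim]) auto
    then obtain I J where IJ: "\<And>n. ((\<lambda>r. f (s n r)) has_integral I n) {0..t}"
      "((\<lambda>r. f (y r)) has_integral J) {0..t}" "I \<longlonglongrightarrow> J"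
      by (rule uniform_limit_integral) (use t in \<open>auto intro: continuous_on_integrand s_cont\<close>)
    have "(\<lambda>n. s (Suc n) t) \<longlonglongrightarrow> y t"
      using tendsto_uniform_limitI[OF lim t] by (rule LIMSEQ_Suc)
    moreover have "(\<lambda>n. s (Suc n) t) \<longlonglongrightarrow> g t + volterra f y t"
      unfolding s_Suc[OF t] volterra_def using IJ(3)
      by (intro tendsto_intros) (simp add: integral_unique[OF IJ(1)] integral_unique[OF IJ(2)])
    ultimately show ?thesis by (rule LIMSEQ_unique)
  qed
  have "\<forall>t\<in>{0..T}. h (y t) = 0" if h: "bounded_linear h"
    and hg: "\<And>i t. t \<in> {0..T} \<Longrightarrow> h ((f ^^ i) (g t)) = 0" for h :: "'a \<Rightarrow> 'b"
  proof
    fix t assume t: "t \<in> {0..T}"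
    have "h (a k t) = 0" for k
      using linear_functional_volterra_funpow[OF g h hg t, of 0 k] by (simp add: a_def)
    then have "h (s n t) = 0" for n
      unfolding s_def using h by (simp add: bounded_linear.linear linear_sum)
    then show "h (y t) = 0"
      using bounded_linear.tendsto[OF h tendsto_uniform_limitI[OF lim t]]
      by (simp add: LIMSEQ_const_iff)
  qed
  with y_cont y_eq show ?thesis by (rule that)
qed

end

section \<open>Existence and uniqueness of the controlled trajectory\<close>

text \<open>On a bounded interval L2 embeds in L1: the function 1 plus the squared norm is an
  integrable majorant, and the endpoints form a null set.\<close>

lemma L2_space_integrable_on:
  assumes "e \<in> L2_space T" shows "e integrable_on {0..T}"
proof -
  have m: "e \<in> borel_measurable (lebesgue_on {0<..<T})"
    and i: "integrable (lebesgue_on {0<..<T}) (\<lambda>t. (norm (e t))\<^sup>2)"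
    using assms by (auto simp: L2_space_def)
  have "integrable (lebesgue_on {0<..<T}) (\<lambda>t. 1 + (norm (e t))\<^sup>2)"
    by (intro Bochner_Integration.integrable_add i)
      (simp add: integrable_restrict_space flip: lmeasurable_iff_integrable)
  then have "integrable (lebesgue_on {0<..<T}) e"
  proof (rule Bochner_Integration.integrable_bound[OF _ m], intro AE_I2)
    fix t
    have "0 \<le> (norm (e t) - 1)\<^sup>2" by simp
    then have "2 * norm (e t) \<le> 1 + (norm (e t))\<^sup>2" by (simp add: power2_eq_square algebra_simps)
    then have "norm (e t) \<le> 1 + (norm (e t))\<^sup>2" using norm_ge_zero[of "e t"] by linarith
    then show "norm (e t) \<le> norm (1 + (norm (e t))\<^sup>2)" by simp
  qed
  then have "e integrable_on {0<..<T}"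
    by (rule integrable_on_lebesgue_on) simp
  then show ?thesis by (simp add: integrable_on_Icc_iff_Ioo)
qed

text \<open>Integrating the control separately leaves a Volterra equation with continuous forcing,
  in which \<open>B\<close> occurs only in the forcing term.\<close>

lemma solves_on_iff:
  assumes e: "e integrable_on {0..T}"
  shows "solves_on T A y0 B e y \<longleftrightarrow> continuous_on {0..T} y \<and>
    (\<forall>t\<in>{0..T}. y t = y0 + B *v integral {0..t} e + volterra ((*v) A) y t)"
proof -
  have "((\<lambda>s. A *v y s + B *v e s) has_integral (y t - y0)) {0..t} \<longleftrightarrow>
      y t = y0 + B *v integral {0..t} e + volterra ((*v) A) y t"
    if y: "continuous_on {0..T} y" and t: "t \<in> {0..T}" for t
  proof -
    have "(\<lambda>s. A *v y s) integrable_on {0..t}"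
      using t by (intro volterra_integrand_integrable[OF matrix_vector_mul_bounded_linear y]) auto
    moreover have "(e has_integral integral {0..t} e) {0..t}"
      using integrable_subinterval_real[OF e, of 0 t] t by auto
    ultimately have "((\<lambda>s. A *v y s + B *v e s) has_integral
        (volterra ((*v) A) y t + B *v integral {0..t} e)) {0..t}"
      unfolding volterra_def
      using has_integral_linear[OF _ matrix_vector_mul_bounded_linear, of e _ _ B]
      by (intro has_integral_add integrable_integral) (auto simp: comp_def)
    then show ?thesis
      by (auto simp: algebra_simps dest: has_integral_unique)
  qed
  then show ?thesis unfolding solves_on_def by auto
qed

lemma continuous_on_forcing:
  fixes e :: "real \<Rightarrow> real^'m" and B :: "real^'m^'n"
  assumes "e integrable_on {0..T}"
  shows "continuous_on {0..T} (\<lambda>t. y0 + B *v integral {0..t} e)"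
  using bounded_linear.continuous_on[OF matrix_vector_mul_bounded_linear
      indefinite_integral_continuous_1[OF assms], of B]
  by (rule continuous_on_add[OF continuous_on_const])

lemma solves_on_unique:
  assumes e: "e integrable_on {0..T}" and "solves_on T A y0 B e y" "solves_on T A y0 B e z"
    and t: "t \<in> {0..T}"
  shows "y t = z t"
proof -
  have c: "continuous_on {0..T} y" "continuous_on {0..T} z"
    and eq: "\<And>t. t \<in> {0..T} \<Longrightarrow> y t = y0 + B *v integral {0..t} e + volterra ((*v) A) y t"
      "\<And>t. t \<in> {0..T} \<Longrightarrow> z t = y0 + B *v integral {0..t} e + volterra ((*v) A) z t"
    using assms(2,3) by (auto simp: solves_on_iff[OF e])
  have "y t - z t = 0"
  proof (rule volterra_homogeneous_unique[OF matrix_vector_mul_bounded_linear _ _ t])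
    show "continuous_on {0..T} (\<lambda>t. y t - z t)" by (intro continuous_intros c)
    fix s assume s: "s \<in> {0..T}"
    have "volterra ((*v) A) (\<lambda>t. y t - z t) s = volterra ((*v) A) y s - volterra ((*v) A) z s"
      unfolding volterra_def matrix_vector_mult_diff_distrib using s c
      by (intro integral_diff volterra_integrand_integrable[OF matrix_vector_mul_bounded_linear]) auto
    then show "y s - z s = volterra ((*v) A) (\<lambda>t. y t - z t) s"
      using eq[OF s] by simp
  qed
  then show ?thesis by simp
qed

text \<open>Uniqueness of solutions makes the definite description in \<open>final_state\<close>
  denote the endpoint of any solution at hand.\<close>

lemma final_state_eq:
  assumes "T \<ge> 0" "e integrable_on {0..T}" "solves_on T A y0 B e y"
  shows "final_state T A y0 B e = y T"
  unfolding final_state_def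
proof (rule the_equality)
  show "\<exists>z. solves_on T A y0 B e z \<and> z T = y T" using assms(3) by blast
  fix z assume "\<exists>x. solves_on T A y0 B e x \<and> x T = z"
  then obtain x where "solves_on T A y0 B e x" "x T = z" by blast
  then show "z = y T"
    using solves_on_unique[OF assms(2) _ assms(3), of x T] assms(1) by simp
qed

section \<open>Invisible perturbations and the unobservable subspace\<close>

lemma matrix_funpow_eq: "((*v) A ^^ k) v = mat_pow A k *v v"
  by (induction k arbitrary: v)
    (simp_all add: funpow_Suc_right matrix_vector_mul_assoc del: funpow.simps(2))

text \<open>By superposition the trajectory for \<open>B + D\<close> is the one for \<open>B\<close>
  plus the response \<open>w\<close> to \<open>D\<close> from initial value 0. Every term of the
  Neumann series of \<open>w\<close> is annihilated by \<open>C\<close>, because every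
  \<open>C A^i D\<close> vanishes.\<close>

lemma final_state_indistinguishable:
  fixes A :: "real^'n^'n" and C :: "real^'n^'p" and B D :: "real^'m^'n"
  assumes T: "T \<ge> 0" and e: "e integrable_on {0..T}"
    and D: "\<And>k v. C *v (mat_pow A k *v (D *v v)) = 0"
  shows "C *v final_state T A y0 (B + D) e = C *v final_state T A y0 B e"
proof -
  let ?f = "(*v) A"
  have f: "bounded_linear ?f" by (rule matrix_vector_mul_bounded_linear)
  obtain y where y: "continuous_on {0..T} y"
    "\<And>t. t \<in> {0..T} \<Longrightarrow> y t = y0 + B *v integral {0..t} e + volterra ?f y t"
    using volterra_solution[OF f continuous_on_forcing[OF e]] by metis
  have "continuous_on {0..T} (\<lambda>t. D *v integral {0..t} e)"
    using continuous_on_forcing[OF e, of 0 D] by simp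
  from volterra_solution[OF f this, where 'b = "real^'p"] obtain w where w: "continuous_on {0..T} w"
    "\<And>t. t \<in> {0..T} \<Longrightarrow> w t = D *v integral {0..t} e + volterra ?f w t"
    and "\<And>h :: real^'n \<Rightarrow> real^'p. \<lbrakk>bounded_linear h;
       \<And>i t. t \<in> {0..T} \<Longrightarrow> h ((?f ^^ i) (D *v integral {0..t} e)) = 0\<rbrakk> \<Longrightarrow> \<forall>t\<in>{0..T}. h (w t) = 0"
    by blast
  from this(3)[of "(*v) C"] have Cw: "C *v w T = 0"
    using T by (auto simp: matrix_funpow_eq D)
  have "solves_on T A y0 (B + D) e (\<lambda>t. y t + w t)"
    unfolding solves_on_iff[OF e]
  proof (intro conjI ballI)
    show "continuous_on {0..T} (\<lambda>t. y t + w t)" by (intro continuous_intros y w)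
    fix t assume t: "t \<in> {0..T}"
    have "volterra ?f (\<lambda>t. y t + w t) t = volterra ?f y t + volterra ?f w t"
      unfolding volterra_def matrix_vector_right_distrib using t y(1) w(1)
      by (intro integral_add volterra_integrand_integrable[OF f]) auto
    then show "y t + w t = y0 + (B + D) *v integral {0..t} e + volterra ?f (\<lambda>t. y t + w t) t"
      using y(2)[OF t] w(2)[OF t] by (simp add: matrix_vector_mult_add_rdistrib)
  qed
  moreover have "solves_on T A y0 B e y"
    using y by (simp add: solves_on_iff[OF e])
  ultimately show ?thesis
    using Cw by (simp add: final_state_eq[OF T e] matrix_vector_right_distrib)
qed

text \<open>In place of the Cayley-Hamilton theorem: the decreasing chain of common kernels of
  C, CA, ..., CA^(k-1) stops at its first repetition, hence after at most N steps.\<close>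
lemma unobservable_subspace_stabilizes:
  fixes A :: "real^'n^'n" and C :: "real^'n^'p"
  assumes "\<And>i. i < CARD('n) \<Longrightarrow> C *v (mat_pow A i *v v) = 0"
  shows "C *v (mat_pow A k *v v) = 0"
proof -
  define S where "S k = {v. \<forall>i<k. C *v (mat_pow A i *v v) = 0}" for k
  have sub: "subspace (S k)" for k
    by (auto simp: S_def subspace_def matrix_vector_right_distrib matrix_vector_mult_scaleR)
  have anti: "S (Suc k) \<subseteq> S k" for k by (auto simp: S_def)
  \<comment> \<open>Each space in the chain is determined by its predecessor alone, so a single
    repetition makes the chain constant from there on.\<close>
  have Suc_iff: "v \<in> S (Suc k) \<longleftrightarrow> C *v v = 0 \<and> A *v v \<in> S k" for v k
    by (auto simp: S_def All_less_Suc2 matrix_vector_mul_assoc matrix_mul_assoc)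
  have "\<exists>k\<le>CARD('n). S (Suc k) = S k"
  proof (rule ccontr)
    assume "\<not> ?thesis"
    then have strict: "S (Suc k) \<subset> S k" if "k \<le> CARD('n)" for k
      using anti[of k] that by blast
    \<comment> \<open>Every strict inclusion costs one dimension; N + 1 of them, starting from
      dimension at most N, are impossible.\<close>
    have "dim (S k) + k \<le> CARD('n)" if "k \<le> Suc (CARD('n))" for k
      using that
    proof (induction k)
      case 0
      then show ?case using dim_subset_UNIV_cart[of "S 0"] by simp
    next
      case (Suc k)
      have "dim (S (Suc k)) < dim (S k)"
        using strict[of k] Suc.prems sub by (intro dim_psubset) (simp add: span_eq_iff[THEN iffD2])
      then show ?case using Suc by simp
    qed
    from this[of "Suc (CARD('n))"] show False by simp
  qed
  then obtain k0 where k0: "k0 \<le> CARD('n)" "S (Suc k0) = S k0" by blast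
  have "S (k0 + j) = S k0" for j
  proof (induction j)
    case (Suc j)
    have "S (Suc (k0 + j)) = S (Suc k0)" using Suc by (auto simp: Suc_iff)
    then show ?case using k0 by simp
  qed simp
  moreover have "v \<in> S k0" using assms k0(1) by (auto simp: S_def)
  \<comment> \<open>Membership in \<open>S n\<close> covers only exponents below \<open>n\<close>;
    the \<open>Suc\<close> makes \<open>k\<close> one of them.\<close>
  ultimately have "v \<in> S (k0 + Suc k)" by blast
  then show ?thesis by (simp add: S_def)
qed

lemma observability_kernel:
  fixes A :: "real^'n^'n" and C :: "real^'n^'p"
  assumes "observability_matrix C A *v v = 0"
  shows "C *v (mat_pow A k *v v) = 0"
proof (rule unobservable_subspace_stabilizes)
  fix i assume "i < CARD('n)"
  \<comment> \<open>The block labels enumerate all exponents below N, so each \<open>C A^i\<close>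
    with i < N really is a block of the observability matrix.\<close>
  then have "i \<in> range (to_nat_on (UNIV :: 'n set))"
    using to_nat_on_finite[of "UNIV :: 'n set"] by (simp add: bij_betw_def)
  then obtain b :: 'n where b: "to_nat_on UNIV b = i" by blast
  have "(C *v (mat_pow A i *v v)) $ r = 0" for r
    using arg_cong[OF assms, of "\<lambda>x. x $ (r, b)"]
    unfolding matrix_vector_mul_assoc
    by (simp add: observability_matrix_def b matrix_vector_mult_def row_def)
  then show "C *v (mat_pow A i *v v) = 0" by (simp add: vec_eq_iff)
qed

section \<open>Dimension counts\<close>

lemma column_matrix_mult: "column j (X ** Y) = X *v column j Y"
  by (simp add: column_def matrix_matrix_mult_def matrix_vector_mult_def vec_eq_iff)

text \<open>A matrix is the sum of its single-column parts \<open>E j (column j Y)\<close>. Placing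
  each vector of a basis of \<open>U\<close> in each of the M columns therefore gives a spanning set
  of at most M times \<open>dim U\<close> matrices.\<close>

lemma dim_columns_in_le:
  fixes X :: "(real^'m^'r) set"
  assumes "\<And>Y j. Y \<in> X \<Longrightarrow> column j Y \<in> U"
  shows "dim X \<le> dim U * CARD('m)"
proof -
  obtain b where b: "b \<subseteq> U" "independent b" "U \<subseteq> span b" "card b = dim U"
    using basis_exists[of U] by blast
  have fin: "finite b" using b(2) by (rule independent_imp_finite)
  define E :: "'m \<Rightarrow> real^'r \<Rightarrow> real^'m^'r" where "E j u = (\<chi> i l. if l = j then u $ i else 0)" for j u
  have lin: "linear (E j)" for j
    by (rule linearI) (auto simp: E_def vec_eq_iff)
  let ?W = "\<Union>j. E j ` b"
  have "X \<subseteq> span ?W"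
  proof
    fix Y assume Y: "Y \<in> X"
    have "Y = (\<Sum>j\<in>UNIV. E j (column j Y))"
      by (simp add: vec_eq_iff E_def column_def)
    moreover have "E j (column j Y) \<in> span ?W" for j
    proof -
      have "E j (column j Y) \<in> E j ` span b" using assms[OF Y] b(3) by blast
      also have "\<dots> = span (E j ` b)" by (rule linear_span_image[OF lin, symmetric])
      also have "\<dots> \<subseteq> span ?W" by (intro span_mono) blast
      finally show ?thesis .
    qed
    ultimately show "Y \<in> span ?W" by (metis (mono_tags, lifting) span_sum)
  qed
  then have "dim X \<le> card ?W" using fin by (intro dim_le_card) auto
  also have "\<dots> \<le> (\<Sum>j\<in>(UNIV :: 'm set). card (E j ` b))" by (intro card_UN_le) simp
  also have "\<dots> \<le> (\<Sum>j\<in>(UNIV :: 'm set). card b)" by (intro sum_mono card_image_le fin)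
  finally show ?thesis using b(4) by (simp add: mult.commute)
qed

text \<open>A vector in the span of the axis vectors for \<open>J\<close> vanishes outside
  \<open>J\<close>; if it lies in the kernel of \<open>L\<close>, it also vanishes on
  \<open>J\<close>. So \<open>L\<close> is injective on this span, whose dimension is
  \<open>card J\<close>.\<close>

lemma card_coordinates_vanishing_on_kernel:
  fixes L :: "real^'k \<Rightarrow> 'v::euclidean_space"
  assumes L: "linear L" and J: "\<And>\<alpha> j. L \<alpha> = 0 \<Longrightarrow> j \<in> J \<Longrightarrow> \<alpha> $ j = 0"
  shows "card J \<le> dim (range L)"
proof -
  let ?E = "(\<lambda>j. axis j (1::real)) ` J :: (real^'k) set"
  have "span ?E \<subseteq> {x. \<forall>i. i \<notin> J \<longrightarrow> x $ i = 0}"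
    by (rule span_minimal) (auto simp: subspace_def axis_def)
  then have supp: "x $ i = 0" if "x \<in> span ?E" "i \<notin> J" for x i
    using that by blast
  have "inj_on L (span ?E)"
    unfolding linear_inj_on_span_iff_independent_image
    using L J supp by (auto simp: linear_injective_on_subspace_0[OF L subspace_span] vec_eq_iff)
  then have "dim (L ` ?E) = dim ?E" by (rule dim_image_eq[OF L])
  moreover have "independent ?E"
    by (rule independent_mono[OF independent_Basis]) (auto simp: Basis_vec_def)
  then have "dim ?E = card J"
    by (simp add: dim_eq_card_independent card_image inj_on_def axis_eq_axis)
  moreover have "dim (L ` ?E) \<le> dim (range L)" by (intro dim_subset) auto
  ultimately show ?thesis by simp
qed

section \<open>Bound on the number of recoverable coefficients\<close>

lemma linear_combine: "linear (combine Bhat)"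
  by (rule linearI) (simp_all add: combine_def scaleR_add_left sum.distrib scaleR_sum_right)

theorem theorem5p15:
  fixes A :: "real^'n^'n" and C :: "real^'n^'p" and y0 :: "real^'n"
    and T :: real and E_ad :: "(real \<Rightarrow> real^'m) set" and R :: nat
    and Bhat :: "'k::finite \<Rightarrow> real^'m^'n" and \<alpha>star :: "real^'k"
    and q :: nat and \<epsilon> :: "nat \<Rightarrow> real \<Rightarrow> real^'m"
  assumes "T > 0"
    and "E_ad \<noteq> {}"
    and "compactin (L2_weak_topology T) E_ad"
    and "rank (observability_matrix C A) = R"
    and "R < CARD('n)"
    and "is_basis_family Bhat"
    and "\<And>m. m \<in> {1..q} \<Longrightarrow> \<epsilon> m \<in> E_ad"
  shows "card {j. \<forall>\<alpha>.
           is_arg_min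
             (\<lambda>\<beta>. \<Sum>m=1..q.
                (norm (C *v final_state T A y0 (combine Bhat \<alpha>star) (\<epsilon> m)
                     - C *v final_state T A y0 (combine Bhat \<beta>) (\<epsilon> m)))\<^sup>2)
             (\<lambda>_. True) \<alpha>
           \<longrightarrow> \<alpha> $ j = \<alpha>star $ j}
         \<le> R * CARD('m)"
proof -
  let ?O = "observability_matrix C A" and ?L = "\<lambda>\<alpha>. observability_matrix C A ** combine Bhat \<alpha>"
  let ?cost = "\<lambda>\<beta>. \<Sum>m=1..q.
                (norm (C *v final_state T A y0 (combine Bhat \<alpha>star) (\<epsilon> m)
                     - C *v final_state T A y0 (combine Bhat \<beta>) (\<epsilon> m)))\<^sup>2"
  let ?J = "{j. \<forall>\<alpha>. is_arg_min ?cost (\<lambda>_. True) \<alpha> \<longrightarrow> \<alpha> $ j = \<alpha>star $ j}"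
  have lin: "linear ?L"
    using linear_combine[of Bhat]
    by (intro linearI) (simp_all add: linear_add linear_cmul matrix_add_ldistrib
        scalar_matrix_assoc matrix_scalar_ac)
  \<comment> \<open>A compact set lies in the carrier of its topology, and all generators of the
    weak topology consist of L2 functions. Hence every control in the family is integrable.\<close>
  have "E_ad \<subseteq> topspace (L2_weak_topology T)"
    using assms(3) by (rule compactin_subset_topspace)
  also have "\<dots> \<subseteq> L2_space T"
    by (auto simp: L2_weak_topology_def)
  finally have int: "\<epsilon> m integrable_on {0..T}" if "m \<in> {1..q}" for m
    using assms(7)[OF that] by (blast intro: L2_space_integrable_on)
  have "card ?J \<le> dim (range ?L)"
  proof (rule card_coordinates_vanishing_on_kernel[OF lin])
    fix \<alpha> j assume ker: "?L \<alpha> = 0" and j: "j \<in> ?J"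
    have "C *v (mat_pow A k *v (combine Bhat \<alpha> *v v)) = 0" for k v
      by (rule observability_kernel) (simp add: matrix_vector_mul_assoc ker)
    \<comment> \<open>A kernel vector leaves every output unchanged. As the cost is a sum of
      squares, the value 0 makes the shifted vector a global minimizer, and recovery of coordinate
      \<open>j\<close> then forces \<open>\<alpha> $ j = 0\<close>.\<close>
    then have "?cost (\<alpha>star + \<alpha>) = 0"
      using assms(1) int
      by (simp add: linear_add[OF linear_combine] final_state_indistinguishable)
    moreover have "0 \<le> ?cost \<beta>" for \<beta> by (intro sum_nonneg) simp
    ultimately have "is_arg_min ?cost (\<lambda>_. True) (\<alpha>star + \<alpha>)"
      by (simp add: is_arg_min_def not_less)
    with j show "\<alpha> $ j = 0" by fastforce
  qed
  also have "\<dots> \<le> dim (range ((*v) ?O)) * CARD('m)"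
  proof (rule dim_columns_in_le)
    fix Y j assume "Y \<in> range ?L"
    then show "column j Y \<in> range ((*v) ?O)"
      by (auto simp: column_matrix_mult)
  qed
  also have "dim (range ((*v) ?O)) = R"
    using assms(4) by (simp add: rank_dim_range)
  finally show ?thesis .
qed

end
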